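(* For every positive integer $k$, there exist infinitely many finite graphs $G_n=(V_n,E_n)$ such that, for each $n$: (1) $\chi_D(G_n)>\chi(G_n)>k$; (2) $G_n$ is vertex-transitive and $|\mathrm{Aut}(G_n)|<2k|V_n|$.
   Context: $\chi(G)$ is the chromatic number of $G$ and $\mathrm{Aut}(G)$ its full automorphism group. The distinguishing chromatic number $\chi_D(G)$ is the least integer $r$ such that $V(G)$ can be partitioned into independent sets $V_1,\dots,V_r$ with the property that for every non-identity automorphism $\varphi$ of $G$ there is some $i$ with $\varphi(V_i)\neq V_i$ (i.e. a proper coloring that no non-trivial automorphism preserves class-wise). *)

theory Defs
  imports
    "HOL-Library.Disjoint_Sets"
    "HOL-Combinatorics.Permutations"
    "Graph_Theory.Graph_Theory"
begin

text \<open>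
  A finite simple graph is a \<^locale>\<open>pair_graph\<close>: a finite vertex set with a symmetric,
  irreflexive set of ordered pairs, each edge being present in both orientations.
\<close>

text \<open>
  Automorphisms act as the identity off the vertex set, so that every automorphism of the
  graph is represented by exactly one function and the trivial one is \<^const>\<open>id\<close>.
\<close>
definition Aut :: "'a pair_pre_digraph \<Rightarrow> ('a \<Rightarrow> 'a) set" where
  "Aut G = {\<phi>. \<phi> permutes pverts G \<and>
     (\<forall>u\<in>pverts G. \<forall>v\<in>pverts G. (u, v) \<in> parcs G \<longleftrightarrow> (\<phi> u, \<phi> v) \<in> parcs G)}"

definition vertex_transitive :: "'a pair_pre_digraph \<Rightarrow> bool" where
  "vertex_transitive G \<longleftrightarrow> (\<forall>u\<in>pverts G. \<forall>v\<in>pverts G. \<exists>\<phi>\<in>Aut G. \<phi> u = v)"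

definition independent_set :: "'a pair_pre_digraph \<Rightarrow> 'a set \<Rightarrow> bool" where
  "independent_set G W \<longleftrightarrow> W \<subseteq> pverts G \<and> (\<forall>u\<in>W. \<forall>v\<in>W. (u, v) \<notin> parcs G)"

text \<open>
  A proper colouring is given by its colour classes. The classes of \<^const>\<open>partition_on\<close> are
  nonempty; this does not affect the least possible number of classes.
\<close>
definition proper_colouring :: "'a pair_pre_digraph \<Rightarrow> 'a set set \<Rightarrow> bool" where
  "proper_colouring G P \<longleftrightarrow> partition_on (pverts G) P \<and> (\<forall>W\<in>P. independent_set G W)"

definition distinguishing :: "'a pair_pre_digraph \<Rightarrow> 'a set set \<Rightarrow> bool" where
  "distinguishing G P \<longleftrightarrow> (\<forall>\<phi>\<in>Aut G. \<phi> \<noteq> id \<longrightarrow> (\<exists>W\<in>P. \<phi> ` W \<noteq> W))"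

text \<open>
  On a finite graph both minima range over nonempty sets, since the partition into singletons
  is a distinguishing proper colouring.
\<close>
definition chromatic_number :: "'a pair_pre_digraph \<Rightarrow> nat" where
  "chromatic_number G = (LEAST r. \<exists>P. finite P \<and> card P = r \<and> proper_colouring G P)"

definition distinguishing_chromatic_number :: "'a pair_pre_digraph \<Rightarrow> nat" where
  "distinguishing_chromatic_number G =
     (LEAST r. \<exists>P. finite P \<and> card P = r \<and> proper_colouring G P \<and> distinguishing G P)"

end

theory Submission
  imports Defs
begin

text \<open>
  Put \<open>N = 2 k m\<close> with \<open>m\<close> large, and let the dihedral group of order \<open>N\<close> live on
  \<open>{0, \<dots>, N - 1}\<close>, the even numbers being the rotations and the odd ones the reflections.
  In the complement of \<open>G\<close>, the residue classes modulo \<open>2 k\<close> are cliques, and in addition \<open>u\<close> is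
  joined to \<open>u d\<close> for the four reflections \<open>d = 1, 7, 9, 13\<close>. A clique of the complement meeting
  two classes has at most 8 vertices, so the classes form the only colouring of \<open>G\<close> with at most
  \<open>2 k\<close> colours, and the rotation by \<open>2 k\<close> fixes every class.

  Automorphisms of \<open>G\<close> permute the classes, hence are automorphisms of the Cayley graph with
  connection set \<open>{1, 7, 9, 13}\<close>. In this graph the edges \<open>d = 9\<close> lie in no 4-cycle, while
  \<open>d = 7\<close> is the only one that forms a 4-cycle with two other edges at the same vertex (from
  \<open>7 - 1 = 13 - 7\<close>). Automorphisms thus commute with right multiplication by 7 and by 9; since
  these two reflections generate the group, only the left multiplications remain.
\<close>

section \<open>General facts on partitions, minimal colourings and isomorphic graphs\<close>

lemma card_partition_on:
  assumes "finite A" "partition_on A P"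
  shows "card A = sum card P"
  using assms by (metis card_Union_disjoint finite_subset Union_upper partition_onD1 partition_onD2)

lemma card_partition_on_le:
  assumes "finite A" "partition_on A P" "\<And>W. W \<in> P \<Longrightarrow> card W \<le> m"
  shows "card A \<le> card P * m"
proof -
  have "card A = sum card P"
    using assms(1,2) by (rule card_partition_on)
  then show ?thesis
    using sum_bounded_above[of P card m] assms(3) by simp
qed

text \<open>Equality case of the counting bound: one smaller class would make the total fall short.
  It later forces the colour classes of a minimal colouring to be maximum independent sets.\<close>

lemma card_partition_on_eqD:
  assumes "finite A" "partition_on A P" "\<And>W. W \<in> P \<Longrightarrow> card W \<le> m"
    and "card P * m \<le> card A" "W \<in> P"
  shows "card W = m"
proof (rule ccontr)
  assume "card W \<noteq> m"
  have fin: "finite P"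
    using assms(1,2) by (rule finite_elements)
  have "card A = sum card P"
    using assms(1,2) by (rule card_partition_on)
  also have "\<dots> < (\<Sum>W\<in>P. m)"
    using fin assms(3,5) \<open>card W \<noteq> m\<close> by (intro sum_strict_mono_ex1) (auto simp: order_less_le)
  finally show False
    using assms(4) by simp
qed

text \<open>The partition into singletons is a witness, since a nontrivial automorphism moves some
  vertex; hence the \<open>LEAST\<close> is attained.\<close>

lemma distinguishing_chromatic_number_attained:
  assumes "pair_graph G"
  obtains P where "finite P" "card P = distinguishing_chromatic_number G"
    "proper_colouring G P" "distinguishing G P"
proof -
  interpret pair_graph G by fact
  let ?P = "(\<lambda>v. {v}) ` pverts G"
  have "proper_colouring G ?P"
    using pair_no_loops
    by (fastforce simp: proper_colouring_def independent_set_def partition_on_singletons)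
  moreover have "distinguishing G ?P"
    unfolding distinguishing_def
  proof (intro ballI impI)
    fix \<phi> assume "\<phi> \<in> Aut G" "\<phi> \<noteq> id"
    then obtain v where "\<phi> v \<noteq> v" "v \<in> pverts G"
      unfolding Aut_def permutes_def by fastforce
    then show "\<exists>W\<in>?P. \<phi> ` W \<noteq> W"
      by auto
  qed
  ultimately have "\<exists>r P. finite P \<and> card P = r \<and> proper_colouring G P \<and> distinguishing G P"
    using pair_finite_verts by blast
  from LeastI_ex[OF this] show thesis
    using that unfolding distinguishing_chromatic_number_def by blast
qed

lemma card_verts_digraph_iso:
  assumes "digraph_iso G H"
  shows "card (verts G) = card (verts H)"
  using assms unfolding digraph_iso_def
  by (auto simp: app_iso_def pre_digraph.digraph_isomorphism_def card_image)

section \<open>The dihedral group of order \<open>N\<close>, its Cayley graph and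
  \<open>graph\<close>\<close>

locale dihedral_graph =
  fixes k m :: nat
  assumes k_pos: "k \<ge> 1" and m_ge: "m \<ge> 13"
begin

definition N :: nat where "N = 2 * k * m"

text \<open>Differences of elements of \<open>D\<close> lie between -12 and 12, so two of them
  differ by at most 24, less than \<open>N\<close>, and congruence modulo \<open>N\<close> becomes
  equality.\<close>

lemma N_ge: "N \<ge> 26"
  using mult_le_mono[OF k_pos m_ge] by (simp add: N_def)

definition par :: "nat \<Rightarrow> int" where
  "par a = (if even a then 1 else -1)"

text \<open>The dihedral product: a rotation on the left adds, a reflection subtracts. Integers
  avoid truncated subtraction; as \<open>N\<close> is even, reduction preserves parity.\<close>

definition mul :: "nat \<Rightarrow> nat \<Rightarrow> nat" where
  "mul a b = nat ((int a + par a * int b) mod int N)"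

lemma int_mul: "int (mul a b) = (int a + par a * int b) mod int N"
  using N_ge by (simp add: mul_def)

lemma mul_less [simp]: "mul a b < N"
  using N_ge by (simp add: mul_def nat_less_iff)

lemma int_mul_mod: "int (mul a b) mod int (2 * k) = (int a + par a * int b) mod int (2 * k)"
  unfolding int_mul by (rule mod_mod_cancel) (simp add: N_def)

lemma even_mul: "even (mul a b) \<longleftrightarrow> even (a + b)"
proof -
  have "int (mul a b) mod 2 = (int a + par a * int b) mod 2"
    unfolding int_mul by (rule mod_mod_cancel) (simp add: N_def)
  then have "even (int (mul a b)) \<longleftrightarrow> even (int a + par a * int b)"
    by (simp add: even_iff_mod_2_eq_zero)
  then show ?thesis
    by (auto simp: par_def)
qed

lemma par_mul: "par (mul a b) = par a * par b"
  by (simp add: par_def even_mul)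

lemma mul_assoc: "mul (mul a b) c = mul a (mul b c)"
proof -
  have "int (mul (mul a b) c) = (int a + par a * int b + par a * par b * int c) mod int N"
    unfolding int_mul par_mul by (simp add: mod_simps)
  also have "\<dots> = (int a + par a * (int b + par b * int c)) mod int N"
    by (simp add: algebra_simps)
  also have "\<dots> = int (mul a (mul b c))"
    unfolding int_mul by (metis mod_add_right_eq mod_mult_right_eq)
  finally show ?thesis by simp
qed

lemma mul_0_right [simp]: "a < N \<Longrightarrow> mul a 0 = a"
  by (simp add: mul_def flip: zmod_int)

lemma mul_0_left [simp]: "b < N \<Longrightarrow> mul 0 b = b"
  by (simp add: mul_def par_def flip: zmod_int)

lemma mul_self: "odd d \<Longrightarrow> mul d d = 0"
  by (simp add: mul_def par_def)

lemma ex_left_inverse: "\<exists>b. mul b a = 0"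
proof (cases "even a")
  case True
  \<comment> \<open>\<open>a * (N - 1)\<close> is a natural number congruent to -a modulo
    \<open>N\<close> and, like \<open>a\<close>, even.\<close>
  have "a * (N - 1) + a = a * N"
    using N_ge by (cases N) auto
  then have "int (a * (N - 1)) + int a = int a * int N"
    by (metis of_nat_add of_nat_mult)
  then have "mul (a * (N - 1)) a = 0"
    using True by (simp add: mul_def par_def)
  then show ?thesis by blast
qed (use mul_self in blast)

lemma mul_left_cancel: "b < N \<Longrightarrow> c < N \<Longrightarrow> mul a b = mul a c \<longleftrightarrow> b = c"
  using ex_left_inverse[of a] by (metis mul_assoc mul_0_left)

text \<open>The positive differences are 2, 4, 6, 6, 8, 12; only 6 repeats. The difference 9 - 7 = 2
  yields a generator of the rotations.\<close>

definition D :: "nat set" where "D = {1, 7, 9, 13}"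

lemma D_cases: "d \<in> D \<Longrightarrow> odd d \<and> d < N"
  using N_ge by (auto simp: D_def)

text \<open>Connection elements multiply on the right, so left multiplications preserve the
  relation.\<close>

definition cay :: "nat \<Rightarrow> nat \<Rightarrow> bool" where
  "cay u v \<longleftrightarrow> (\<exists>d\<in>D. v = mul u d)"

definition graph :: "nat pair_pre_digraph" where
  "graph = \<lparr>pverts = {..<N},
     parcs = {(u, v). u < N \<and> v < N \<and> u mod (2 * k) \<noteq> v mod (2 * k) \<and> \<not> cay u v}\<rparr>"

lemma pverts_graph [simp]: "pverts graph = {..<N}"
  by (simp add: graph_def)

lemma parcs_graph:
  "u < N \<Longrightarrow> v < N \<Longrightarrow>
    (u, v) \<in> parcs graph \<longleftrightarrow> u mod (2 * k) \<noteq> v mod (2 * k) \<and> \<not> cay u v"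
  by (simp add: graph_def)

lemma cay_sym: "u < N \<Longrightarrow> cay u v \<Longrightarrow> cay v u"
  unfolding cay_def using D_cases mul_self by (metis mul_assoc mul_0_right)

lemma cay_parity: "cay u v \<Longrightarrow> even v \<longleftrightarrow> odd u"
  using D_cases by (auto simp: cay_def even_mul)

lemma even_if_mod_eq: "u mod (2 * k) = v mod (2 * k) \<Longrightarrow> even u \<longleftrightarrow> even v"
  by (metis dvd_mod_iff dvd_triv_left)

lemma cay_mul: "u < N \<Longrightarrow> v < N \<Longrightarrow> cay (mul a u) (mul a v) \<longleftrightarrow> cay u v"
  unfolding cay_def by (simp add: mul_assoc mul_left_cancel)

text \<open>Because \<open>2 * k\<close> divides \<open>N\<close>, left multiplication by
  \<open>a\<close> acts on residues as a translation or a reflection.\<close>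

lemma mod_mul: "mul a u mod (2 * k) = mul a v mod (2 * k) \<longleftrightarrow> u mod (2 * k) = v mod (2 * k)"
proof -
  have "mul a u mod (2 * k) = mul a v mod (2 * k) \<longleftrightarrow>
      int (mul a u) mod int (2 * k) = int (mul a v) mod int (2 * k)"
    by (metis of_nat_eq_iff zmod_int)
  also have "\<dots> \<longleftrightarrow> int (2 * k) dvd par a * (int u - int v)"
    unfolding int_mul_mod by (simp add: mod_eq_dvd_iff algebra_simps)
  also have "\<dots> \<longleftrightarrow> int (2 * k) dvd int u - int v"
    by (auto simp: par_def dvd_diff_commute)
  also have "\<dots> \<longleftrightarrow> u mod (2 * k) = v mod (2 * k)"
    by (metis mod_eq_dvd_iff of_nat_eq_iff zmod_int)
  finally show ?thesis .
qed

sublocale pair_graph graph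
proof
  show "Digraph.symmetric (with_proj graph)"
    using cay_sym by (auto simp: symmetric_def sym_def graph_def)
  show "finite (parcs graph)"
    by (rule finite_subset[of _ "{..<N} \<times> {..<N}"]) (auto simp: graph_def)
qed (auto simp: graph_def)

text \<open>Left multiplication, extended by the identity as membership in \<open>Aut\<close>
  demands.\<close>

definition lmul :: "nat \<Rightarrow> nat \<Rightarrow> nat" where
  "lmul a v = (if v < N then mul a v else v)"

lemma lmul_in_Aut: "lmul a \<in> Aut graph"
proof -
  have "inj_on (mul a) {..<N}"
    by (auto simp: inj_on_def mul_left_cancel)
  then have "bij_betw (mul a) {..<N} {..<N}"
    by (simp add: bij_betw_def endo_inj_surj image_subset_iff)
  then have "bij_betw (lmul a) {..<N} {..<N}"
    by (rule bij_betw_cong[THEN iffD1, rotated]) (simp add: lmul_def)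
  then have "lmul a permutes {..<N}"
    by (rule bij_imp_permutes) (simp add: lmul_def)
  then show ?thesis
    by (auto simp: Aut_def parcs_graph lmul_def cay_mul mod_mul)
qed

lemma vertex_transitive_graph: "vertex_transitive graph"
  unfolding vertex_transitive_def
proof (intro ballI)
  fix u v assume uv: "u \<in> pverts graph" "v \<in> pverts graph"
  obtain b where b: "mul b u = 0"
    using ex_left_inverse by blast
  have "lmul (mul v b) u = v"
    using uv b by (simp add: lmul_def mul_assoc)
  then show "\<exists>\<phi>\<in>Aut graph. \<phi> u = v"
    using lmul_in_Aut by blast
qed

section \<open>Residue classes, independent sets and colourings\<close>

definition cls :: "nat \<Rightarrow> nat set" where
  "cls j = {v. v < N \<and> v mod (2 * k) = j}"

lemma card_cls:
  assumes "j < 2 * k"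
  shows "card (cls j) = m"
proof -
  have "cls j = (\<lambda>i. 2 * k * i + j) ` {..<m}"
  proof (intro set_eqI iffI)
    fix v assume "v \<in> cls j"
    then have "v = 2 * k * (v div (2 * k)) + j" "v div (2 * k) < m"
      by (auto simp: cls_def N_def less_mult_imp_div_less mult.commute)
    then show "v \<in> (\<lambda>i. 2 * k * i + j) ` {..<m}"
      by blast
  next
    fix v assume "v \<in> (\<lambda>i. 2 * k * i + j) ` {..<m}"
    then obtain i where i: "i < m" "v = 2 * k * i + j" by blast
    have "2 * k * i + j < 2 * k * Suc i"
      using assms by simp
    also have "\<dots> \<le> N"
      unfolding N_def using i by (intro mult_le_mono) auto
    finally show "v \<in> cls j"
      using i assms by (simp add: cls_def)
  qed
  moreover have "inj_on (\<lambda>i. 2 * k * i + j) {..<m}"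
    using k_pos by (auto simp: inj_on_def)
  ultimately show ?thesis
    by (simp add: card_image)
qed

lemma finite_cls [simp]: "finite (cls j)"
  by (rule finite_subset[of _ "{..<N}"]) (auto simp: cls_def)

lemma independent_cls: "independent_set graph (cls j)"
  by (auto simp: independent_set_def cls_def parcs_graph)

text \<open>If \<open>W\<close> contains \<open>u\<close> and \<open>v\<close> from different
  classes, every vertex of \<open>W\<close> is outside one of these two classes, hence a Cayley
  neighbour of \<open>u\<close> or \<open>v\<close>. This leaves at most 4 + 4 vertices.\<close>

lemma independent_subset_cls:
  assumes W: "independent_set graph W" and "card W > 8"
  shows "\<exists>j<2 * k. W \<subseteq> cls j"
proof -
  have WN: "w < N" if "w \<in> W" for w
    using W that by (auto simp: independent_set_def)
  have alt: "cay u v" if "u \<in> W" "v \<in> W" "u mod (2 * k) \<noteq> v mod (2 * k)" for u v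
    using W that WN parcs_graph unfolding independent_set_def by blast
  have same: "u mod (2 * k) = v mod (2 * k)" if "u \<in> W" "v \<in> W" for u v
  proof (rule ccontr)
    assume ne: "u mod (2 * k) \<noteq> v mod (2 * k)"
    have "W \<subseteq> mul u ` D \<union> mul v ` D"
    proof
      fix w assume "w \<in> W"
      have "odd (u + v)"
        using alt[OF that ne] cay_parity by auto
      then have "w mod (2 * k) \<noteq> u mod (2 * k) \<or> w mod (2 * k) \<noteq> v mod (2 * k)"
        using even_if_mod_eq by (metis even_add)
      then have "cay u w \<or> cay v w"
        using alt \<open>w \<in> W\<close> that by metis
      then show "w \<in> mul u ` D \<union> mul v ` D"
        by (auto simp: cay_def)
    qed
    then have "card W \<le> card (mul u ` D \<union> mul v ` D)"
      by (rule card_mono[rotated]) (simp add: D_def)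
    also have "\<dots> \<le> card (mul u ` D) + card (mul v ` D)"
      by (rule card_Un_le)
    also have "\<dots> \<le> card D + card D"
      by (intro add_mono card_image_le) (simp_all add: D_def)
    also have "\<dots> = 8"
      by (simp add: D_def)
    finally show False
      using \<open>card W > 8\<close> by simp
  qed
  obtain w where "w \<in> W"
    using \<open>card W > 8\<close> by fastforce
  then have "W \<subseteq> cls (w mod (2 * k))"
    unfolding cls_def using WN same by blast
  moreover have "w mod (2 * k) < 2 * k"
    using k_pos by simp
  ultimately show ?thesis by blast
qed

lemma card_independent_le:
  assumes "independent_set graph W"
  shows "card W \<le> m"
proof (cases "card W > 8")
  case True
  then obtain j where "j < 2 * k" "W \<subseteq> cls j"
    using independent_subset_cls assms by blast
  then show ?thesis
    using card_mono[of "cls j" W] card_cls by simp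
qed (use m_ge in simp)

lemma independent_eq_cls:
  assumes "independent_set graph W" "card W = m"
  shows "\<exists>j<2 * k. W = cls j"
proof -
  obtain j where "j < 2 * k" "W \<subseteq> cls j"
    using independent_subset_cls assms m_ge by fastforce
  then show ?thesis
    using card_subset_eq[of "cls j" W] assms card_cls by auto
qed

lemma proper_colouring_card_ge:
  assumes "proper_colouring graph P"
  shows "2 * k \<le> card P"
proof -
  have "2 * k * m \<le> card P * m"
    using card_partition_on_le[of "{..<N}" P m] assms card_independent_le
    by (simp add: proper_colouring_def N_def)
  then show ?thesis
    using m_ge by simp
qed

text \<open>At most \<open>2 * k\<close> independent sets of size at most \<open>m\<close> cover
  \<open>2 * k * m\<close> vertices, so each has size exactly \<open>m\<close> and is a full residue
  class.\<close>

lemma proper_colouring_unique: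
  assumes "proper_colouring graph P" "card P \<le> 2 * k" "W \<in> P"
  shows "\<exists>j<2 * k. W = cls j"
proof (rule independent_eq_cls)
  show "independent_set graph W"
    using assms by (simp add: proper_colouring_def)
  show "card W = m"
    using card_partition_on_eqD[of "{..<N}" P m W] assms card_independent_le
    by (simp add: proper_colouring_def N_def)
qed

lemma chromatic_number_graph: "chromatic_number graph = 2 * k"
  unfolding chromatic_number_def
proof (rule Least_equality)
  let ?P = "cls ` {..<2 * k}"
  have ne: "cls j \<noteq> {}" if "j < 2 * k" for j
    using card_cls[OF that] m_ge by auto
  have "inj_on cls {..<2 * k}"
    using ne by (fastforce simp: inj_on_def cls_def)
  then have "card ?P = 2 * k"
    by (simp add: card_image)
  moreover have "partition_on {..<N} ?P"
  proof (rule partition_onI)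
    show "\<Union> ?P = {..<N}"
      using k_pos by (auto simp: cls_def)
    show "disjnt p q" if "p \<in> ?P" "q \<in> ?P" "p \<noteq> q" for p q
      using that by (auto simp: cls_def disjnt_def)
    show "{} \<notin> ?P"
      using ne by auto
  qed
  ultimately show "\<exists>P. finite P \<and> card P = 2 * k \<and> proper_colouring graph P"
    using independent_cls by (intro exI[of _ ?P]) (auto simp: proper_colouring_def)
qed (use proper_colouring_card_ge in blast)

text \<open>As \<open>2 * k\<close> is even, this is the translation by \<open>2 * k\<close>, which
  keeps residues.\<close>

lemma lmul_cls: "lmul (2 * k) ` cls j = cls j"
proof (rule card_subset_eq)
  have "mul (2 * k) v mod (2 * k) = v mod (2 * k)" for v
  proof -
    have "int (mul (2 * k) v mod (2 * k)) = int (v mod (2 * k))"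
      using int_mul_mod[of "2 * k" v] by (simp add: par_def zmod_int)
    then show ?thesis by simp
  qed
  then show "lmul (2 * k) ` cls j \<subseteq> cls j"
    by (auto simp: cls_def lmul_def)
  have "inj_on (lmul (2 * k)) (cls j)"
    by (auto simp: inj_on_def cls_def lmul_def mul_left_cancel)
  then show "card (lmul (2 * k) ` cls j) = card (cls j)"
    by (rule card_image)
qed simp

lemma distinguishing_chromatic_number_gt: "distinguishing_chromatic_number graph > 2 * k"
proof (rule ccontr)
  assume le: "\<not> distinguishing_chromatic_number graph > 2 * k"
  obtain P where P: "card P = distinguishing_chromatic_number graph"
    "proper_colouring graph P" "distinguishing graph P"
    using distinguishing_chromatic_number_attained[OF pair_graph] by blast
  \<comment> \<open>The rotation by \<open>2 * k\<close> moves 0 and so is nontrivial.\<close>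
  have "2 * k < N"
    using k_pos m_ge by (simp add: N_def)
  then have "lmul (2 * k) 0 = 2 * k"
    by (simp add: lmul_def)
  then have "lmul (2 * k) \<noteq> id"
    using k_pos by auto
  then obtain W where "W \<in> P" "lmul (2 * k) ` W \<noteq> W"
    using P(3) lmul_in_Aut[of "2 * k"] unfolding distinguishing_def by metis
  moreover obtain j where "W = cls j"
    using proper_colouring_unique[OF P(2) _ \<open>W \<in> P\<close>] le P(1) by auto
  ultimately show False
    by (simp add: lmul_cls)
qed

section \<open>Automorphisms of \<open>graph\<close> and their rigidity\<close>

lemma Aut_permutes: "\<phi> \<in> Aut graph \<Longrightarrow> \<phi> permutes {..<N}"
  by (simp add: Aut_def)

lemma Aut_less: "\<phi> \<in> Aut graph \<Longrightarrow> v < N \<Longrightarrow> \<phi> v < N"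
  using permutes_in_image[OF Aut_permutes, of \<phi> v] by simp

lemma Aut_eq_iff: "\<phi> \<in> Aut graph \<Longrightarrow> \<phi> u = \<phi> v \<longleftrightarrow> u = v"
  using permutes_inj[OF Aut_permutes] by (simp add: inj_eq)

text \<open>The image of a class is again independent of size \<open>m\<close>, and such sets are
  classes.\<close>

lemma Aut_cls:
  assumes "\<phi> \<in> Aut graph" "j < 2 * k"
  shows "\<exists>i<2 * k. \<phi> ` cls j = cls i"
proof (rule independent_eq_cls)
  show "independent_set graph (\<phi> ` cls j)"
    unfolding independent_set_def
  proof (intro conjI ballI)
    have cls: "v < N" "(u, v) \<notin> parcs graph" if "u \<in> cls j" "v \<in> cls j" for u v
      using independent_cls[of j] that by (auto simp: independent_set_def)
    show "\<phi> ` cls j \<subseteq> pverts graph"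
      using cls(1) Aut_less[OF assms(1)] by auto
    fix x y assume "x \<in> \<phi> ` cls j" "y \<in> \<phi> ` cls j"
    then obtain u v where "x = \<phi> u" "y = \<phi> v" "u \<in> cls j" "v \<in> cls j"
      by blast
    with assms(1) cls show "(x, y) \<notin> parcs graph"
      by (auto simp: Aut_def)
  qed
  show "card (\<phi> ` cls j) = m"
    using assms by (simp add: card_image inj_on_def Aut_eq_iff card_cls)
qed

lemma Aut_mod_eq:
  assumes "\<phi> \<in> Aut graph" "u < N" "v < N"
  shows "\<phi> u mod (2 * k) = \<phi> v mod (2 * k) \<longleftrightarrow> u mod (2 * k) = v mod (2 * k)"
proof -
  have "u mod (2 * k) < 2 * k"
    using k_pos by simp
  then obtain i where i: "\<phi> ` cls (u mod (2 * k)) = cls i"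
    using Aut_cls assms(1) by blast
  have mem: "w mod (2 * k) = u mod (2 * k) \<longleftrightarrow> \<phi> w mod (2 * k) = i" if "w < N" for w
  proof -
    have "w mod (2 * k) = u mod (2 * k) \<longleftrightarrow> w \<in> cls (u mod (2 * k))"
      using that by (simp add: cls_def)
    also have "\<dots> \<longleftrightarrow> \<phi> w \<in> cls i"
      unfolding i[symmetric] using Aut_eq_iff[OF assms(1)] by auto
    also have "\<dots> \<longleftrightarrow> \<phi> w mod (2 * k) = i"
      using that Aut_less[OF assms(1)] by (simp add: cls_def)
    finally show ?thesis .
  qed
  have "\<phi> u mod (2 * k) = i"
    using mem[OF assms(2)] by simp
  with mem[OF assms(3)] show ?thesis
    by metis
qed

text \<open>Cayley edges change parity, so they join different classes. They are thus exactly the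
  non-adjacent pairs from different classes, a description that automorphisms preserve.\<close>

lemma Aut_cay:
  assumes "\<phi> \<in> Aut graph" "u < N" "v < N"
  shows "cay (\<phi> u) (\<phi> v) \<longleftrightarrow> cay u v"
proof -
  have cay_iff: "cay x y \<longleftrightarrow> x mod (2 * k) \<noteq> y mod (2 * k) \<and> (x, y) \<notin> parcs graph"
    if "x < N" "y < N" for x y
    using that parcs_graph cay_parity even_if_mod_eq by blast
  have "(\<phi> u, \<phi> v) \<in> parcs graph \<longleftrightarrow> (u, v) \<in> parcs graph"
    using assms by (auto simp: Aut_def)
  then show ?thesis
    using cay_iff Aut_less assms Aut_mod_eq by simp
qed

text \<open>For Cayley neighbours \<open>w\<close> and \<open>w'\<close> of \<open>u\<close>, this
  says that the edges from \<open>u\<close> to them lie on a common 4-cycle with opposite corner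
  \<open>x\<close>.\<close>

definition quad :: "nat \<Rightarrow> nat \<Rightarrow> nat \<Rightarrow> bool" where
  "quad u w w' \<longleftrightarrow> w \<noteq> w' \<and> (\<exists>x<N. x \<noteq> u \<and> cay w x \<and> cay w' x)"

lemma Aut_quad:
  assumes "\<phi> \<in> Aut graph" "u < N" "w < N" "w' < N" "quad u w w'"
  shows "quad (\<phi> u) (\<phi> w) (\<phi> w')"
  using assms Aut_cay Aut_less Aut_eq_iff unfolding quad_def by metis

lemma mul_D_eq_iff:
  assumes "a \<in> D" "b \<in> D" "c \<in> D" "d \<in> D"
  shows "mul a c = mul b d \<longleftrightarrow> int a - int c = int b - int d"
proof
  assume "mul a c = mul b d"
  then have "(int a - int c) mod int N = (int b - int d) mod int N"
    using D_cases assms int_mul[of a c] int_mul[of b d] by (simp add: par_def)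
  then have "int N dvd (int a - int c) - (int b - int d)"
    by (simp only: mod_eq_dvd_iff)
  moreover have "\<bar>(int a - int c) - (int b - int d)\<bar> < int N"
  proof -
    have "1 \<le> x \<and> x \<le> 13" if "x \<in> D" for x
      using that by (auto simp: D_def)
    from this[of a] this[of b] this[of c] this[of d] show ?thesis
      using assms N_ge by linarith
  qed
  ultimately show "int a - int c = int b - int d"
    using dvd_imp_le_int[of "int a - int c - (int b - int d)" "int N"] by linarith
next
  assume "int a - int c = int b - int d"
  then show "mul a c = mul b d"
    using D_cases assms by (simp add: mul_def par_def)
qed

text \<open>The corner opposite \<open>u\<close> is \<open>u a c = u b d\<close>, so a 4-cycle is a
  solution of \<open>a - c = b - d\<close> with \<open>a\<close> different from \<open>b\<close> and
  \<open>c\<close>. Only the repeated difference 7 - 1 = 13 - 7 provides one.\<close>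

lemma quad_iff:
  assumes "u < N" "a \<in> D" "b \<in> D"
  shows "quad u (mul u a) (mul u b) \<longleftrightarrow> (a = 7 \<and> b \<in> {1, 13}) \<or> (b = 7 \<and> a \<in> {1, 13})"
proof -
  have eq: "mul u (mul a c) = mul u (mul b d) \<longleftrightarrow> int a - int c = int b - int d"
    if "c \<in> D" "d \<in> D" for c d
    using that assms mul_D_eq_iff by (simp add: mul_left_cancel)
  have ne: "mul u (mul a c) = u \<longleftrightarrow> c = a" if "c \<in> D" for c
  proof -
    have "mul u (mul a c) = u \<longleftrightarrow> mul u (mul a c) = mul u (mul a a)"
      using assms D_cases by (simp add: mul_self)
    also have "\<dots> \<longleftrightarrow> c = a"
      using that assms D_cases by (simp add: mul_left_cancel)
    finally show ?thesis .
  qed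
  have "quad u (mul u a) (mul u b) \<longleftrightarrow>
      a \<noteq> b \<and> (\<exists>x<N. x \<noteq> u \<and> cay (mul u a) x \<and> cay (mul u b) x)"
    using assms D_cases by (simp add: quad_def mul_left_cancel)
  also have "\<dots> \<longleftrightarrow> a \<noteq> b \<and>
      (\<exists>c\<in>D. \<exists>d\<in>D. mul u (mul a c) \<noteq> u \<and> mul u (mul a c) = mul u (mul b d))"
    unfolding cay_def mul_assoc using mul_less by blast
  also have "\<dots> \<longleftrightarrow> a \<noteq> b \<and> (\<exists>c\<in>D. \<exists>d\<in>D. c \<noteq> a \<and> int a - int c = int b - int d)"
    by (intro conj_cong bex_cong refl) (simp_all only: eq ne)
  \<comment> \<open>A finite check over the 16 pairs from \<open>D\<close>.\<close>
  also have "\<dots> \<longleftrightarrow> (a = 7 \<and> b \<in> {1, 13}) \<or> (b = 7 \<and> a \<in> {1, 13})"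
    using assms(2,3) unfolding D_def by (elim insertE) simp_all
  finally show ?thesis .
qed

text \<open>At each vertex the relation \<open>quad\<close> on the four directions is the path 1 - 7
  - 13 with 9 isolated. The induced map on directions preserves it, so it fixes 7 and 9, though it
  might still swap 1 and 13.\<close>

lemma Aut_mul:
  assumes "\<phi> \<in> Aut graph" "u < N"
  shows "\<phi> (mul u 7) = mul (\<phi> u) 7" "\<phi> (mul u 9) = mul (\<phi> u) 9"
proof -
  have "\<exists>e\<in>D. \<phi> (mul u d) = mul (\<phi> u) e" if "d \<in> D" for d
    using Aut_cay[OF assms, of "mul u d"] that by (auto simp: cay_def)
  then obtain f where f: "f d \<in> D" "\<phi> (mul u d) = mul (\<phi> u) (f d)" if "d \<in> D" for d
    by metis
  have inj: "f c \<noteq> f d" if "c \<in> D" "d \<in> D" "c \<noteq> d" for c d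
    using f that Aut_eq_iff[OF assms(1)] mul_left_cancel[of c d u] D_cases by metis
  have quad: "(f c = 7 \<and> f d \<in> {1, 13}) \<or> (f d = 7 \<and> f c \<in> {1, 13})"
    if "c \<in> D" "d \<in> D" "quad u (mul u c) (mul u d)" for c d
    using Aut_quad[OF assms, of "mul u c" "mul u d"] f[of c] f[of d] that
      quad_iff[of "\<phi> u" "f c" "f d"] Aut_less[OF assms]
    by simp
  have D: "1 \<in> D" "7 \<in> D" "9 \<in> D" "13 \<in> D"
    by (auto simp: D_def)
  have "(f 7 = 7 \<and> f 1 \<in> {1, 13}) \<or> (f 1 = 7 \<and> f 7 \<in> {1, 13})"
    "(f 7 = 7 \<and> f 13 \<in> {1, 13}) \<or> (f 13 = 7 \<and> f 7 \<in> {1, 13})"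
    using quad[of 7 1] quad[of 7 13] quad_iff assms(2) D by auto
  moreover have "f 1 \<noteq> f 13" "f 9 \<noteq> f 1" "f 9 \<noteq> f 7" "f 9 \<noteq> f 13"
    using inj D by auto
  \<comment> \<open>If 7 were not fixed, both 1 and 13 would go to 7, against injectivity. Hence 1
    and 13 are permuted, and only 9 remains for \<open>f 9\<close>.\<close>
  ultimately have "f 7 = 7 \<and> f 9 = 9"
    using f(1)[OF D(3)] unfolding D_def by auto
  then show "\<phi> (mul u 7) = mul (\<phi> u) 7" "\<phi> (mul u 9) = mul (\<phi> u) 9"
    using f D by auto
qed

text \<open>Agreement at 0 spreads along right multiplication by 7 and 9, which reaches every
  vertex.\<close>

lemma Aut_eqI:
  assumes \<phi>: "\<phi> \<in> Aut graph" and \<psi>: "\<psi> \<in> Aut graph" and "\<phi> 0 = \<psi> 0"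
  shows "\<phi> = \<psi>"
proof
  have step: "\<phi> (mul u d) = \<psi> (mul u d)" if "\<phi> u = \<psi> u" "u < N" "d = 7 \<or> d = 9" for u d
    using that Aut_mul \<phi> \<psi> by metis
  have ev: "\<phi> (2 * j) = \<psi> (2 * j)" if "2 * j < N" for j
    using that
  proof (induction j)
    case 0
    then show ?case using assms by simp
  next
    case (Suc j)
    \<comment> \<open>The first factor adds 9 and gives an odd number; the second then subtracts
      7.\<close>
    have "int (mul (mul (2 * j) 9) 7) = int (2 * Suc j)"
      using Suc.prems unfolding int_mul par_mul by (simp add: par_def mod_simps)
    then have "2 * Suc j = mul (mul (2 * j) 9) 7"
      by linarith
    moreover have "\<phi> (2 * j) = \<psi> (2 * j)"
      using Suc by simp
    ultimately show ?case
      using step Suc.prems by (metis mul_less Suc_lessD mult_Suc_right add_2_eq_Suc)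
  qed
  fix v
  show "\<phi> v = \<psi> v"
  proof (cases "v < N")
    case True
    show ?thesis
    proof (cases "even v")
      case True
      with \<open>v < N\<close> show ?thesis using ev by (auto elim!: evenE)
    next
      case False
      \<comment> \<open>An odd \<open>v\<close> is one step from an even vertex, and 7 is an
        involution.\<close>
      then have "even (mul v 7)"
        by (simp add: even_mul)
      then have "\<phi> (mul v 7) = \<psi> (mul v 7)"
        using ev mul_less by (metis evenE)
      then have "\<phi> (mul (mul v 7) 7) = \<psi> (mul (mul v 7) 7)"
        using step by simp
      then show ?thesis
        using True by (simp add: mul_assoc mul_self)
    qed
  next
    case False
    then show ?thesis
      using Aut_permutes \<phi> \<psi> by (metis lessThan_iff permutes_not_in)
  qed
qed

lemma card_Aut_le: "card (Aut graph) \<le> N"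
proof -
  have "card (Aut graph) \<le> card {..<N}"
  proof (rule card_inj_on_le)
    show "inj_on (\<lambda>\<phi>. \<phi> 0) (Aut graph)"
      using Aut_eqI by (auto simp: inj_on_def)
    show "(\<lambda>\<phi>. \<phi> 0) ` Aut graph \<subseteq> {..<N}"
      using Aut_less N_ge by auto
  qed simp
  then show ?thesis by simp
qed

end

section \<open>The infinite family\<close>

theorem theorem1p1:
  fixes k :: nat
  assumes "k \<ge> 1"
  shows "\<exists>G :: nat \<Rightarrow> nat pair_pre_digraph.
    (\<forall>m n. m \<noteq> n \<longrightarrow> \<not> digraph_iso (with_proj (G m)) (with_proj (G n))) \<and>
    (\<forall>n. pair_graph (G n) \<and>
      distinguishing_chromatic_number (G n) > chromatic_number (G n) \<and>
      chromatic_number (G n) > k \<and>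
      vertex_transitive (G n) \<and>
      card (Aut (G n)) < 2 * k * card (pverts (G n)))"
proof (intro exI conjI allI impI)
  \<comment> \<open>The shift by 13 meets the locale bound on \<open>m\<close>; different
    \<open>n\<close> give different orders, hence non-isomorphic graphs.\<close>
  define G where "G = (\<lambda>n. dihedral_graph.graph k (n + 13))"
  have loc: "dihedral_graph k (n + 13)" for n
    using assms by unfold_locales auto
  have card: "card (pverts (G n)) = 2 * k * (n + 13)" for n
    unfolding G_def dihedral_graph.pverts_graph[OF loc] dihedral_graph.N_def[OF loc] by simp
  show "\<not> digraph_iso (with_proj (G m)) (with_proj (G n))" if "m \<noteq> n" for m n
    using card_verts_digraph_iso[of "with_proj (G m)" "with_proj (G n)"] that assms card by auto
  fix n
  interpret dihedral_graph k "n + 13" by (rule loc)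
  show "pair_graph (G n)"
    unfolding G_def by (rule pair_graph)
  show "distinguishing_chromatic_number (G n) > chromatic_number (G n)"
    using distinguishing_chromatic_number_gt unfolding G_def chromatic_number_graph .
  show "chromatic_number (G n) > k"
    using assms unfolding G_def chromatic_number_graph by simp
  show "vertex_transitive (G n)"
    unfolding G_def by (rule vertex_transitive_graph)
  have "card (Aut (G n)) \<le> N"
    using card_Aut_le unfolding G_def .
  also have "\<dots> < 2 * k * N"
    using assms N_ge by simp
  finally show "card (Aut (G n)) < 2 * k * card (pverts (G n))"
    unfolding G_def by simp
qed

end
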